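(* (Semi-discrete conservation of energy.) Consider a solution of the semi-discrete penalized Legendre-Fourier Vlasov-Poisson system $$\frac{d\mathbf{C}^s_k}{dt}+\Big(\frac{2\pi i}{L}k\Big)\mathbb{A}\mathbf{C}^s_k-\frac{q^s}{m^s}\Big[E\star\big(\mathbb{B}\mathbf{C}^s-\gamma^s\delta_v[f^s\boldsymbol\phi]_{v_a}^{v_b}\big)\Big]_k=\mathbb{D}^s_\nu\mathbf{C}^s_k,\qquad -N_F\le k\le N_F,\ s\in\{e,i\}.$$ Then the total energy $$\mathcal{E}_{tot}(t)=\sum_{s\in\{e,i\}}\frac{m^s}{2}\int_0^L\int_{v_a}^{v_b}v^2f^s(x,v,t)\,dv\,dx+\frac{\epsilon_0}{2}\int_0^LE(x,t)^2\,dx$$ satisfies $$\frac{d\mathcal{E}_{tot}}{dt}=\sum_{s\in\{e,i\}}\mathcal{B}^s_{kin}+\mathcal{B}_{pot},$$ where $$\mathcal{B}^s_{kin}=-\gamma^s\frac{q^s}{2}(v_b-v_a)L\Big[E\star\big(\sigma_1\sigma_2\,\delta_v[f^s\phi_2]_{v_a}^{v_b}+2\sigma_1\overline\sigma\,\delta_v[f^s\phi_1]_{v_a}^{v_b}+(\sigma_1^2+\sigma_0^2+\overline\sigma^2)\,\delta_v[f^s\phi_0]_{v_a}^{v_b}\big)\Big]_0,$$ $$\mathcal{B}_{pot}=-\sum_{\substack{k=-N_F\\k\neq0}}^{N_F}E_k\sum_{s\in\{e,i\}}\gamma^sQ^s_{-k},\qquad Q^s_k=\Big(\frac{2\pi i}{L}k\Big)^{-1}(v_b-v_a)L\,\frac{(q^s)^2}{m^s}\Big[E\star\delta_v[f^s\phi_0]_{v_a}^{v_b}\Big]_k\quad(k\ne0).$$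 The boundary term on the right-hand side is zero if $f^s(x,v_a,t)=f^s(x,v_b,t)=0$ for all $x\in[0,L]$ and $s\in\{e,i\}$.
   Context: Let $L>0$, $v_a<v_b$, integers $N_L\ge4$, $N_F\ge0$; species $s\in\{e,i\}$ have mass $m^s>0$ and charge $q^s\in\mathbb{R}$; $\epsilon_0>0$; $\gamma^s\in\mathbb{R}$ is a penalty coefficient and $\nu_s\ge0$ a collision coefficient. Let $L_n$ be the Legendre polynomials on $[-1,1]$ ($L_0=1$, $L_1(\eta)=\eta$, $(2n+1)\eta L_n=(n+1)L_{n+1}+nL_{n-1}$), $\phi_n(v)=\sqrt{2n+1}\,L_n\big((2v-(v_a+v_b))/(v_b-v_a)\big)$, $\boldsymbol\phi=(\phi_0,\dots,\phi_{N_L-1})^T$, $\psi_k(x)=e^{2\pi i kx/L}$. Constants: $\overline\sigma=\frac{v_a+v_b}{2}$, $\sigma_0=0$, $\sigma_n=\frac{v_b-v_a}{2}\frac{n}{\sqrt{(2n+1)(2n-1)}}$ for $n\ge1$; $\sigma_{n,i}=\pi_{n,i}\frac{2\sqrt{(2n+1)(2i+1)}}{v_b-v_a}$ with $\pi_{n,i}=0$ if $n-i$ is even, $1$ if odd. $f^s(x,v,t)=\sum_{n=0}^{N_L-1}C^s_n(x,t)\phi_n(v)$, $C^s_n(x,t)=\sum_{k=-N_F}^{N_F}C^s_{n,k}(t)\psi_k(x)$ (real-valued), $\mathbf{C}^s=(C^s_n)_{n=0}^{N_L-1}$, $\mathbf{C}^s_k=(C^s_{n,k})_{n=0}^{N_L-1}$,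 with conventions $C^s_{-1}=C^s_{N_L}=0$. Matrices: $(\mathbb{A}\mathbf{C}^s_k)_n=\sigma_{n+1}C^s_{n+1,k}+\sigma_nC^s_{n-1,k}+\overline\sigma C^s_{n,k}$; $(\mathbb{B}\mathbf{C}^s)_n=\sum_{i=0}^{n-1}\sigma_{n,i}C^s_i$; $\mathbb{D}^s_\nu$ is diagonal with entries $D^s_n=-\nu_s\frac{n(n-1)(n-2)}{(N_L-1)(N_L-2)(N_L-3)}$. The electric field $E(x,t)=\sum_{k=-N_F}^{N_F}E_k(t)\psi_k(x)$ is real-valued, with $E_0=0$ and (Poisson equation) $\epsilon_0\big(\frac{2\pi i}{L}k\big)E_k=(v_b-v_a)\sum_{s\in\{e,i\}}q^sC^s_{0,k}$ for $k\ne0$. For $g(x,v,t)$, $\delta_v[g]_{v_a}^{v_b}=\frac{g(x,v_b,t)-g(x,v_a,t)}{v_b-v_a}$. For a trigonometric polynomial $h(x)$ (possibly vector-valued) with Fourier coefficients $h_j=\frac1L\int_0^Lh\,\psi_{-j}\,dx$, $[E\star h]_k=\sum_{k'=-N_F}^{N_F}E_{k'}h_{k-k'}$. *)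

theory Defs
  imports "HOL-Analysis.Analysis"
begin

datatype species = electron | ion

(* (n+2) L_{n+2} = (2n+3) x L_{n+1} - (n+1) L_n *)
fun legendre :: "nat \<Rightarrow> real \<Rightarrow> real" where
  "legendre 0 x = 1"
| "legendre (Suc 0) x = x"
| "legendre (Suc (Suc n)) x =
     ((2 * real n + 3) * x * legendre (Suc n) x - (real n + 1) * legendre n x) / (real n + 2)"

definition phi :: "real \<Rightarrow> real \<Rightarrow> nat \<Rightarrow> real \<Rightarrow> real" where
  "phi va vb n v = sqrt (2 * real n + 1) * legendre n ((2 * v - (va + vb)) / (vb - va))"

definition psi :: "real \<Rightarrow> int \<Rightarrow> real \<Rightarrow> complex" where
  "psi L k x = exp (2 * of_real pi * \<i> * of_int k * of_real x / of_real L)"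

definition wavenum :: "real \<Rightarrow> int \<Rightarrow> complex" where
  "wavenum L k = 2 * of_real pi * \<i> / of_real L * of_int k"

definition sigma_bar :: "real \<Rightarrow> real \<Rightarrow> real" where
  "sigma_bar va vb = (va + vb) / 2"

definition sigma :: "real \<Rightarrow> real \<Rightarrow> nat \<Rightarrow> real" where
  "sigma va vb n =
     (if n = 0 then 0
      else (vb - va) / 2 * (real n / sqrt ((2 * real n + 1) * (2 * real n - 1))))"

(* used only for i < n, so the truncated subtraction n - i is the true difference *)
definition sigma_B :: "real \<Rightarrow> real \<Rightarrow> nat \<Rightarrow> nat \<Rightarrow> real" where
  "sigma_B va vb n i =
     (if even (n - i) then 0 else 1) *
     (2 * sqrt ((2 * real n + 1) * (2 * real i + 1)) / (vb - va))"

(* The operators below act on vectors (c_0, ..., c_{NL-1}), represented as functions on nat of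
   which only the entries below NL are used; c_{-1} and c_{NL} are read as 0. *)

definition op_A :: "real \<Rightarrow> real \<Rightarrow> nat \<Rightarrow> (nat \<Rightarrow> complex) \<Rightarrow> nat \<Rightarrow> complex" where
  "op_A va vb NL c n =
     of_real (sigma va vb (n + 1)) * (if n + 1 < NL then c (n + 1) else 0)
     + of_real (sigma va vb n) * (if n = 0 then 0 else c (n - 1))
     + of_real (sigma_bar va vb) * c n"

definition op_B :: "real \<Rightarrow> real \<Rightarrow> (nat \<Rightarrow> real) \<Rightarrow> nat \<Rightarrow> real" where
  "op_B va vb c n = (\<Sum>i<n. sigma_B va vb n i * c i)"

definition damping :: "nat \<Rightarrow> real \<Rightarrow> nat \<Rightarrow> real" where
  "damping NL \<nu> n =
     - \<nu> * (real n * (real n - 1) * (real n - 2)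
            / ((real NL - 1) * (real NL - 2) * (real NL - 3)))"

definition delta_v :: "real \<Rightarrow> real \<Rightarrow> (real \<Rightarrow> real) \<Rightarrow> real" where
  "delta_v va vb g = (g vb - g va) / (vb - va)"

definition fourier_coeff :: "real \<Rightarrow> (real \<Rightarrow> complex) \<Rightarrow> int \<Rightarrow> complex" where
  "fourier_coeff L h j = 1 / of_real L * integral {0..L} (\<lambda>x. h x * psi L (- j) x)"

(* [E * h]_k for E given by its Fourier coefficients Ek and h given as a function of x;
   vector-valued h are treated componentwise. *)
definition conv ::
    "real \<Rightarrow> nat \<Rightarrow> (int \<Rightarrow> complex) \<Rightarrow> (real \<Rightarrow> complex) \<Rightarrow> int \<Rightarrow> complex" where
  "conv L NF Ek h k = (\<Sum>k'\<in>{- int NF..int NF}. Ek k' * fourier_coeff L h (k - k'))"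

(* In the definitions below, f (of arguments x and v), E and Ek are taken at a fixed time. *)

definition total_energy ::
    "real \<Rightarrow> real \<Rightarrow> real \<Rightarrow> real \<Rightarrow> (species \<Rightarrow> real) \<Rightarrow>
     (species \<Rightarrow> real \<Rightarrow> real \<Rightarrow> real) \<Rightarrow> (real \<Rightarrow> real) \<Rightarrow> real" where
  "total_energy L va vb \<epsilon>0 m f E =
     (\<Sum>s\<in>{electron, ion}.
        m s / 2 * integral {0..L} (\<lambda>x. integral {va..vb} (\<lambda>v. v\<^sup>2 * f s x v)))
     + \<epsilon>0 / 2 * integral {0..L} (\<lambda>x. (E x)\<^sup>2)"

definition B_kin ::
    "real \<Rightarrow> real \<Rightarrow> real \<Rightarrow> nat \<Rightarrow> real \<Rightarrow> real \<Rightarrow>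
     (int \<Rightarrow> complex) \<Rightarrow> (real \<Rightarrow> real \<Rightarrow> real) \<Rightarrow> complex" where
  "B_kin L va vb NF q \<gamma> Ek f =
     - of_real (\<gamma> * (q / 2) * (vb - va) * L) *
     conv L NF Ek
       (\<lambda>x. of_real
          (sigma va vb 1 * sigma va vb 2 * delta_v va vb (\<lambda>v. f x v * phi va vb 2 v)
           + 2 * sigma va vb 1 * sigma_bar va vb * delta_v va vb (\<lambda>v. f x v * phi va vb 1 v)
           + ((sigma va vb 1)\<^sup>2 + (sigma va vb 0)\<^sup>2 + (sigma_bar va vb)\<^sup>2)
             * delta_v va vb (\<lambda>v. f x v * phi va vb 0 v))) 0"

(* used only for k \<noteq> 0 *)
definition Q_pot ::
    "real \<Rightarrow> real \<Rightarrow> real \<Rightarrow> nat \<Rightarrow> real \<Rightarrow> real \<Rightarrow>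
     (int \<Rightarrow> complex) \<Rightarrow> (real \<Rightarrow> real \<Rightarrow> real) \<Rightarrow> int \<Rightarrow> complex" where
  "Q_pot L va vb NF q m Ek f k =
     inverse (wavenum L k) * of_real ((vb - va) * L * (q\<^sup>2 / m)) *
     conv L NF Ek (\<lambda>x. of_real (delta_v va vb (\<lambda>v. f x v * phi va vb 0 v))) k"

definition B_pot ::
    "real \<Rightarrow> real \<Rightarrow> real \<Rightarrow> nat \<Rightarrow> (species \<Rightarrow> real) \<Rightarrow> (species \<Rightarrow> real) \<Rightarrow>
     (species \<Rightarrow> real) \<Rightarrow> (int \<Rightarrow> complex) \<Rightarrow> (species \<Rightarrow> real \<Rightarrow> real \<Rightarrow> real) \<Rightarrow> complex" where
  "B_pot L va vb NF q m \<gamma> Ek f =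
     - (\<Sum>k\<in>{- int NF..int NF} - {0}. Ek k *
          (\<Sum>s\<in>{electron, ion}. of_real (\<gamma> s) * Q_pot L va vb NF (q s) (m s) Ek (f s) (- k)))"

end

theory Submission
  imports Defs
begin

text \<open>
  The total energy only sees a few coefficients, and the two contributions exchange energy exactly,
  up to the boundary terms.

  \<^emph>\<open>Kinetic energy.\<close> The three-term recurrence
  \<open>v \<phi>\<^sub>n = \<sigma>\<^sub>n\<^sub>+\<^sub>1 \<phi>\<^sub>n\<^sub>+\<^sub>1 + \<sigma>\<^sub>n \<phi>\<^sub>n\<^sub>-\<^sub>1 + \<sigma>\<^sub>b\<^sub>a\<^sub>r \<phi>\<^sub>n\<close> (\<open>phi_recurrence\<close>) together with
  the vanishing of the mean of \<open>\<phi>\<^sub>n\<close> for \<open>n > 0\<close> (\<open>has_integral_phi\<close>) determines the second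
  moments of all \<open>\<phi>\<^sub>n\<close> (\<open>has_integral_square_times_phi\<close>). They vanish for \<open>n > 2\<close>, so the kinetic
  energy is a combination of the mean modes (\<open>k = 0\<close>) of \<open>C\<^sub>0\<close>, \<open>C\<^sub>1\<close>, \<open>C\<^sub>2\<close> (\<open>kinetic_moment\<close>).
  For these modes advection drops out because \<open>k = 0\<close> and collisions drop out because
  \<open>n (n - 1) (n - 2) = 0\<close>. What remains is the penalty, which is the kinetic boundary term, and the work
  of the electric field. Since \<open>\<sigma>\<^sub>1 \<sigma>\<^sub>1\<^sub>,\<^sub>0 = 1\<close> and \<open>\<sigma>\<^sub>2 \<sigma>\<^sub>2\<^sub>,\<^sub>1 = 2\<close> (\<open>sigma_times_sigma_B\<close>), the latter is
  \<open>(v\<^sub>b - v\<^sub>a) L\<close> times the charge-weighted sum over the species of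
  \<open>\<Sum>\<^sub>k E\<^sub>k (\<sigma>\<^sub>1 C\<^sub>1\<^sub>,\<^sub>-\<^sub>k + \<sigma>\<^sub>b\<^sub>a\<^sub>r C\<^sub>0\<^sub>,\<^sub>-\<^sub>k)\<close> (\<open>kinetic_rate\<close>).

  \<^emph>\<open>Field energy.\<close> By Parseval it is \<open>(\<epsilon>\<^sub>0 L / 2) \<Sum>\<^sub>k E\<^sub>k E\<^sub>-\<^sub>k\<close>. The Poisson equation makes each \<open>E\<^sub>k\<close>
  a linear combination of the \<open>C\<^sub>0\<^sub>,\<^sub>k\<close>, hence differentiable in time. The equation for \<open>n = 0\<close> has no
  forcing and no collisions; the wavenumber in its advection term cancels that of the Poisson
  equation and leaves minus the work above, while its penalty term gives the potential boundary term
  (\<open>potential_rate\<close>). Adding the two rates cancels the work.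
\<close>

section \<open>Legendre polynomials and their second moments\<close>

text \<open>The derivatives of the Legendre polynomials, defined by differentiating the three-term recurrence.\<close>

fun legendre_deriv :: "nat \<Rightarrow> real \<Rightarrow> real" where
  "legendre_deriv 0 x = 0"
| "legendre_deriv (Suc 0) x = 1"
| "legendre_deriv (Suc (Suc n)) x =
     ((2 * real n + 3) * (legendre (Suc n) x + x * legendre_deriv (Suc n) x)
        - (real n + 1) * legendre_deriv n x) / (real n + 2)"

lemma has_real_derivative_legendre:
  "(legendre n has_real_derivative legendre_deriv n x) (at x within S)"
proof (induction n x rule: legendre.induct)
  case (1 x)
  have "legendre 0 = (\<lambda>x. 1)" by (rule ext) simp
  then show ?case by simp
next
  case (2 x)
  have "legendre (Suc 0) = (\<lambda>x. x)" by (rule ext) simp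
  then show ?case by simp
next
  case (3 n x)
  have e: "legendre (Suc (Suc n)) = (\<lambda>x.
     ((2 * real n + 3) * (x * legendre (Suc n) x) - (real n + 1) * legendre n x) / (real n + 2))"
    by (rule ext) (simp add: mult.assoc)
  have "((\<lambda>x. x * legendre (Suc n) x) has_real_derivative
      legendre (Suc n) x + x * legendre_deriv (Suc n) x) (at x within S)"
    using DERIV_mult[OF DERIV_ident 3(1)] by (simp add: add.commute mult.commute)
  then show ?case
    unfolding e legendre_deriv.simps by (intro DERIV_cdivide DERIV_diff DERIV_cmult 3)
qed

text \<open>The two identities are proved jointly: the induction step for the first uses the second, and the
  step for the second uses both.\<close>

lemma legendre_deriv_identities:
  "legendre_deriv (Suc n) x = (real n + 1) * legendre n x + x * legendre_deriv n x"
  "x * legendre_deriv (Suc n) x - legendre_deriv n x = (real n + 1) * legendre (Suc n) x"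
proof (induction n)
  case 0
  show "legendre_deriv (Suc 0) x = (real 0 + 1) * legendre 0 x + x * legendre_deriv 0 x"
    "x * legendre_deriv (Suc 0) x - legendre_deriv 0 x = (real 0 + 1) * legendre (Suc 0) x"
    by simp_all
next
  case (Suc n)
  define a where "a = legendre_deriv (Suc (Suc n)) x"
  define l where "l = legendre (Suc (Suc n)) x"
  have a: "(real n + 2) * a = (2 * real n + 3) * (legendre (Suc n) x + x * legendre_deriv (Suc n) x)
        - (real n + 1) * legendre_deriv n x"
    by (simp add: a_def)
  have l: "(real n + 2) * l = (2 * real n + 3) * x * legendre (Suc n) x - (real n + 1) * legendre n x"
    by (simp add: l_def)
  have d: "legendre_deriv n x = x * legendre_deriv (Suc n) x - (real n + 1) * legendre (Suc n) x"
    using Suc.IH(2) by simp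
  have "(real n + 2) * a = (real n + 2) * ((real n + 2) * legendre (Suc n) x + x * legendre_deriv (Suc n) x)"
    unfolding a d by (simp add: algebra_simps)
  then have a': "a = (real n + 2) * legendre (Suc n) x + x * legendre_deriv (Suc n) x"
    by simp
  have c: "(x * x - 1) * legendre_deriv (Suc n) x
      = (real n + 1) * (x * legendre (Suc n) x - legendre n x)"
    using Suc.IH(1) unfolding d by (simp add: algebra_simps)
  show "legendre_deriv (Suc (Suc n)) x =
      (real (Suc n) + 1) * legendre (Suc n) x + x * legendre_deriv (Suc n) x"
    using a' by (simp add: a_def algebra_simps)
  have "x * a - legendre_deriv (Suc n) x = (real n + 2) * x * legendre (Suc n) x
      + (x * x - 1) * legendre_deriv (Suc n) x"
    unfolding a' by (simp add: algebra_simps)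
  also have "\<dots> = (real n + 2) * l"
    unfolding c l by (simp add: algebra_simps)
  finally show "x * legendre_deriv (Suc (Suc n)) x - legendre_deriv (Suc n) x
      = (real (Suc n) + 1) * legendre (Suc (Suc n)) x"
    by (simp add: a_def l_def algebra_simps)
qed

lemma legendre_deriv_diff:
  "legendre_deriv (Suc (Suc n)) x - legendre_deriv n x = (2 * real n + 3) * legendre (Suc n) x"
  using legendre_deriv_identities(1)[of "Suc n" x] legendre_deriv_identities(2)[of x n]
  by (simp add: algebra_simps del: legendre_deriv.simps)

lemma legendre_at_1: "legendre n 1 = 1"
  by (induction n "1::real" rule: legendre.induct) (simp_all add: field_simps)

lemma legendre_at_minus_1: "legendre n (-1) = (-1) ^ n"
  by (induction n "-1::real" rule: legendre.induct) (simp_all add: field_simps)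

lemma phi_0: "phi va vb 0 v = 1"
  by (simp add: phi_def)

text \<open>For \<open>n > 0\<close> an antiderivative of \<open>L\<^sub>n\<close> is \<open>(L\<^sub>n\<^sub>+\<^sub>1 - L\<^sub>n\<^sub>-\<^sub>1) / (2 n + 1)\<close>, which vanishes at both
  end points \<open>1\<close> and \<open>-1\<close> because the indices have the same parity.\<close>

lemma has_integral_phi:
  assumes "va < vb"
  shows "(phi va vb n has_integral (if n = 0 then vb - va else 0)) {va..vb}"
proof (cases n)
  case 0
  have "((\<lambda>v. 1 :: real) has_integral (vb - va)) {va..vb}"
    using has_integral_const_real[of "1::real" va vb] assms by simp
  moreover have "phi va vb 0 = (\<lambda>v. 1)"
    by (rule ext) (simp add: phi_0)
  ultimately show ?thesis using 0 by simp
next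
  case (Suc p)
  define \<eta> where "\<eta> = (\<lambda>v. (2 * v - (va + vb)) / (vb - va))"
  define c where "c = sqrt (2 * real n + 1) * ((vb - va) / 2) / (2 * real p + 3)"
  define G where "G = (\<lambda>v. c * (legendre (Suc n) (\<eta> v) - legendre p (\<eta> v)))"
  have \<eta>': "(\<eta> has_real_derivative 2 / (vb - va)) (at v within {va..vb})" for v
    unfolding \<eta>_def by (intro DERIV_cdivide) (auto intro!: derivative_eq_intros)
  have "(G has_real_derivative phi va vb n v) (at v within {va..vb})" for v
  proof -
    have L: "((\<lambda>v. legendre k (\<eta> v)) has_real_derivative legendre_deriv k (\<eta> v) * (2 / (vb - va)))
       (at v within {va..vb})" for k
      using DERIV_chain[OF has_real_derivative_legendre[of k "\<eta> v" UNIV] \<eta>'[of v]] by (simp add: o_def)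
    have "c * (legendre_deriv (Suc n) (\<eta> v) * (2 / (vb - va)) - legendre_deriv p (\<eta> v) * (2 / (vb - va)))
       = c * (2 / (vb - va)) * (legendre_deriv (Suc (Suc p)) (\<eta> v) - legendre_deriv p (\<eta> v))"
      unfolding Suc by (simp only: algebra_simps)
    also have "\<dots> = (c * (2 / (vb - va)) * (2 * real p + 3)) * legendre n (\<eta> v)"
      unfolding legendre_deriv_diff Suc by (simp only: mult.assoc)
    also have "c * (2 / (vb - va)) * (2 * real p + 3) = sqrt (2 * real n + 1)"
    proof -
      define z where "z = 2 * real p + 3"
      have "z \<noteq> 0" by (simp add: z_def)
      then show ?thesis using assms unfolding c_def z_def[symmetric] by simp
    qed
    finally have e: "c * (legendre_deriv (Suc n) (\<eta> v) * (2 / (vb - va)) - legendre_deriv p (\<eta> v) * (2 / (vb - va)))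
       = phi va vb n v"
      unfolding phi_def \<eta>_def .
    show ?thesis
      unfolding G_def e[symmetric] by (intro DERIV_cmult DERIV_diff L)
  qed
  then have "(phi va vb n has_integral (G vb - G va)) {va..vb}"
    using assms
    by (intro fundamental_theorem_of_calculus)
      (auto simp: has_real_derivative_iff_has_vector_derivative)
  moreover have "\<eta> vb = 1" "\<eta> va = -1"
    using assms by (simp_all add: \<eta>_def field_simps)
  ultimately show ?thesis
    unfolding G_def by (simp add: Suc legendre_at_1 legendre_at_minus_1 del: legendre.simps)
qed

text \<open>For \<open>n = 0\<close> the truncated index \<open>n - 1\<close> is harmless since \<open>\<sigma>\<^sub>0 = 0\<close>.\<close>

lemma phi_recurrence:
  assumes "va < vb"
  shows "v * phi va vb n v = sigma va vb (Suc n) * phi va vb (Suc n) v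
    + sigma va vb n * phi va vb (n - 1) v + sigma_bar va vb * phi va vb n v"
proof -
  define \<eta> where "\<eta> = (2 * v - (va + vb)) / (vb - va)"
  define d where "d = (vb - va) / 2"
  have v: "v = d * \<eta> + sigma_bar va vb"
    using assms by (simp add: \<eta>_def d_def sigma_bar_def field_simps)
  define r where "r = (\<lambda>k. sqrt (2 * real k + 1))"
  have r: "r k > 0" "r k * r k = 2 * real k + 1" for k
    by (simp_all add: r_def)
  have s: "sigma va vb (Suc k) = d * ((real k + 1) / (r (Suc k) * r k))" for k
    unfolding sigma_def d_def r_def real_sqrt_mult[symmetric] by (simp add: add.commute)
  have p: "phi va vb k v = r k * legendre k \<eta>" for k
    by (simp add: phi_def r_def \<eta>_def)
  have up: "sigma va vb (Suc k) * phi va vb (Suc k) v = d * ((real k + 1) / r k) * legendre (Suc k) \<eta>" for k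
    unfolding s p using r(1)[of "Suc k"] by simp
  have down: "sigma va vb (Suc k) * phi va vb k v = d * ((real k + 1) / r (Suc k)) * legendre k \<eta>" for k
    unfolding s p using r(1)[of "k"] by simp
  have "d * \<eta> * phi va vb n v = sigma va vb (Suc n) * phi va vb (Suc n) v + sigma va vb n * phi va vb (n - 1) v"
  proof (cases n)
    case 0
    then show ?thesis
      using up[of 0] by (simp add: p r_def sigma_def d_def)
  next
    case (Suc k)
    have "(real k + 2) * legendre (Suc (Suc k)) \<eta>
        = (2 * real k + 3) * \<eta> * legendre (Suc k) \<eta> - (real k + 1) * legendre k \<eta>"
      by simp
    then have "(real k + 2) * legendre (Suc (Suc k)) \<eta> + (real k + 1) * legendre k \<eta>
        = r n * r n * \<eta> * legendre n \<eta>"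
      unfolding r(2) by (simp add: Suc del: legendre.simps)
    then have "d / r n * ((real k + 2) * legendre (Suc (Suc k)) \<eta> + (real k + 1) * legendre k \<eta>)
        = d / r n * (r n * r n * \<eta> * legendre n \<eta>)"
      by (rule arg_cong)
    also have "\<dots> = d * \<eta> * (r n * legendre n \<eta>)"
      using r(1)[of n] by simp
    finally have "d / r n * ((real k + 2) * legendre (Suc (Suc k)) \<eta> + (real k + 1) * legendre k \<eta>)
        = d * \<eta> * (r n * legendre n \<eta>)" .
    moreover have "d / r n * ((real k + 2) * legendre (Suc (Suc k)) \<eta> + (real k + 1) * legendre k \<eta>)
       = sigma va vb (Suc n) * phi va vb (Suc n) v + sigma va vb n * phi va vb (n - 1) v"
      using up[of n] down[of k] by (simp add: Suc algebra_simps add_divide_distrib del: legendre.simps)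
    ultimately show ?thesis
      unfolding p by simp
  qed
  then show ?thesis
    by (subst v) (simp add: algebra_simps)
qed

lemma has_integral_times_phi:
  assumes "va < vb"
  shows "((\<lambda>v. v * phi va vb n v) has_integral
    (vb - va) * (if n = 0 then sigma_bar va vb else if n = 1 then sigma va vb 1 else 0)) {va..vb}"
proof -
  note I = has_integral_phi[OF assms]
  have "((\<lambda>v. v * phi va vb n v) has_integral
     sigma va vb (Suc n) * (if Suc n = 0 then vb - va else 0)
     + sigma va vb n * (if n - 1 = 0 then vb - va else 0)
     + sigma_bar va vb * (if n = 0 then vb - va else 0)) {va..vb}"
    unfolding phi_recurrence[OF assms, of _ n]
    by (intro has_integral_add has_integral_mult_right I)
  then show ?thesis
    by (rule has_integral_eq_rhs) (auto simp: sigma_def)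
qed

lemma has_integral_square_times_phi:
  assumes "va < vb"
  shows "((\<lambda>v. v\<^sup>2 * phi va vb n v) has_integral
    (vb - va) * (if n = 0 then (sigma va vb 1)\<^sup>2 + (sigma va vb 0)\<^sup>2 + (sigma_bar va vb)\<^sup>2
      else if n = 1 then 2 * sigma va vb 1 * sigma_bar va vb
      else if n = 2 then sigma va vb 1 * sigma va vb 2 else 0)) {va..vb}"
proof -
  note I = has_integral_times_phi[OF assms]
  have e: "v\<^sup>2 * phi va vb n v = sigma va vb (Suc n) * (v * phi va vb (Suc n) v)
    + sigma va vb n * (v * phi va vb (n - 1) v) + sigma_bar va vb * (v * phi va vb n v)" for v
    using arg_cong[OF phi_recurrence[OF assms, of v n], of "(*) v"]
    by (simp only: power2_eq_square distrib_left mult_ac)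
  have "((\<lambda>v. v\<^sup>2 * phi va vb n v) has_integral
     sigma va vb (Suc n) * ((vb - va) * (if Suc n = 0 then sigma_bar va vb else if Suc n = 1 then sigma va vb 1 else 0))
     + sigma va vb n * ((vb - va) * (if n - 1 = 0 then sigma_bar va vb else if n - 1 = 1 then sigma va vb 1 else 0))
     + sigma_bar va vb * ((vb - va) * (if n = 0 then sigma_bar va vb else if n = 1 then sigma va vb 1 else 0))) {va..vb}"
    unfolding e by (intro has_integral_add has_integral_mult_right I)
  then show ?thesis
  proof (rule has_integral_eq_rhs)
    have s: "sigma va vb 0 = 0" by (simp add: sigma_def)
    consider "n = 0" | "n = 1" | "n = 2" | "n > 2" by linarith
    then show "(vb - va) * (if n = 0 then (sigma va vb 1)\<^sup>2 + (sigma va vb 0)\<^sup>2 + (sigma_bar va vb)\<^sup>2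
        else if n = 1 then 2 * sigma va vb 1 * sigma_bar va vb
        else if n = 2 then sigma va vb 1 * sigma va vb 2 else 0)
      = sigma va vb (Suc n) * ((vb - va) * (if Suc n = 0 then sigma_bar va vb else if Suc n = 1 then sigma va vb 1 else 0))
     + sigma va vb n * ((vb - va) * (if n - 1 = 0 then sigma_bar va vb else if n - 1 = 1 then sigma va vb 1 else 0))
     + sigma_bar va vb * ((vb - va) * (if n = 0 then sigma_bar va vb else if n = 1 then sigma va vb 1 else 0))"
      by cases (auto simp: s power2_eq_square algebra_simps)
  qed
qed

section \<open>Trigonometric polynomials and convolution\<close>

lemma psi_0: "psi L 0 x = 1"
  by (simp add: psi_def)

lemma psi_mult: "psi L j x * psi L k x = psi L (j + k) x"
  by (simp add: psi_def exp_add[symmetric] add_divide_distrib[symmetric] algebra_simps)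

lemma continuous_on_psi: "continuous_on S (psi L k)"
  unfolding psi_def divide_inverse by (intro continuous_intros)

lemma wavenum_eq_0_iff: "L \<noteq> 0 \<Longrightarrow> wavenum L k = 0 \<longleftrightarrow> k = 0"
  by (simp add: wavenum_def)

lemma has_integral_psi:
  assumes "L > 0"
  shows "(psi L k has_integral (if k = 0 then of_real L else 0)) {0..L}"
proof (cases "k = 0")
  case True
  have "((\<lambda>x. 1 :: complex) has_integral of_real L) {0..L}"
    using has_integral_const_real[of "1::complex" 0 L] assms by (simp add: scaleR_conv_of_real)
  moreover have "psi L 0 = (\<lambda>x. 1)" by (rule ext) (simp add: psi_0)
  ultimately show ?thesis using True by simp
next
  case False
  define w where "w = wavenum L k"
  have w: "w \<noteq> 0" using assms False by (simp add: w_def wavenum_eq_0_iff)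
  have psi: "psi L k x = exp (w * of_real x)" for x
    by (simp add: psi_def w_def wavenum_def)
  have "(psi L k has_integral (exp (w * of_real L) / w - exp (w * of_real 0) / w)) {0..L}"
  proof (rule fundamental_theorem_of_calculus)
    show "0 \<le> L" using assms by simp
    fix x assume "x \<in> {0..L}"
    have "((\<lambda>z. exp (w * z) / w) has_field_derivative exp (w * of_real x)) (at (of_real x))"
      using w by (auto intro!: derivative_eq_intros)
    then show "((\<lambda>x. exp (w * of_real x) / w) has_vector_derivative psi L k x) (at x within {0..L})"
      unfolding psi by (rule has_vector_derivative_real_field)
  qed
  moreover have "exp (w * of_real L) = 1"
  proof -
    have "w * of_real L = 2 * of_real (of_int k) * of_real pi * \<i>"
      using assms by (simp add: w_def wavenum_def)
    then show ?thesis
      unfolding exp_eq_1 by auto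
  qed
  ultimately show ?thesis using False by simp
qed

lemma fourier_coeff_trig_poly:
  assumes "L > 0" and "\<And>x. h x = (\<Sum>k\<in>{- int NF..int NF}. c k * psi L k x)"
    and "j \<in> {- int NF..int NF}"
  shows "fourier_coeff L h j = c j"
proof -
  have "((\<lambda>x. \<Sum>k\<in>{- int NF..int NF}. c k * psi L (k - j) x) has_integral
      (\<Sum>k\<in>{- int NF..int NF}. c k * (if k - j = 0 then of_real L else 0))) {0..L}"
    by (intro has_integral_sum has_integral_mult_right has_integral_psi assms(1)) auto
  moreover have "h x * psi L (- j) x = (\<Sum>k\<in>{- int NF..int NF}. c k * psi L (k - j) x)" for x
    using psi_mult[of L _ x "- j"] by (simp add: assms(2) sum_distrib_right mult.assoc)
  moreover have "(\<Sum>k\<in>{- int NF..int NF}. c k * (if k - j = 0 then of_real L else 0)) = c j * of_real L"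
    using assms(3) by (simp add: if_distrib[of "\<lambda>z. c _ * z"] sum.delta cong: if_cong)
  ultimately show ?thesis
    using assms(1) by (simp add: fourier_coeff_def integral_unique)
qed

lemma has_integral_trig_poly:
  assumes "L > 0" and "\<And>x. complex_of_real (h x) = (\<Sum>k\<in>{- int NF..int NF}. c k * psi L k x)"
  shows "(h has_integral Re (of_real L * c 0)) {0..L}"
    and "complex_of_real (integral {0..L} h) = of_real L * c 0"
proof -
  have "((\<lambda>x. \<Sum>k\<in>{- int NF..int NF}. c k * psi L k x) has_integral
      (\<Sum>k\<in>{- int NF..int NF}. c k * (if k = 0 then of_real L else 0))) {0..L}"
    by (intro has_integral_sum has_integral_mult_right has_integral_psi assms(1)) auto
  moreover have "(\<Sum>k\<in>{- int NF..int NF}. c k * (if k = 0 then of_real L else 0)) = of_real L * c 0"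
    by (simp add: if_distrib[of "\<lambda>z. c _ * z"] sum.delta cong: if_cong)
  ultimately have I: "((\<lambda>x. complex_of_real (h x)) has_integral of_real L * c 0) {0..L}"
    by (simp add: assms(2))
  from has_integral_Re[OF I] show h: "(h has_integral Re (of_real L * c 0)) {0..L}"
    by simp
  from has_integral_unique[OF has_integral_of_real[OF h] I] h
  show "complex_of_real (integral {0..L} h) = of_real L * c 0"
    by (simp add: integral_unique)
qed

text \<open>Parseval's identity; since \<open>h\<close> is real, the coefficient of index \<open>-k\<close> takes the place of the
  complex conjugate.\<close>

lemma integral_trig_poly_square:
  assumes "L > 0" and "\<And>x. complex_of_real (h x) = (\<Sum>k\<in>{- int NF..int NF}. c k * psi L k x)"
  shows "complex_of_real (integral {0..L} (\<lambda>x. (h x)\<^sup>2))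
    = of_real L * (\<Sum>k\<in>{- int NF..int NF}. c k * c (- k))"
proof -
  let ?K = "{- int NF..int NF}"
  have "((\<lambda>x. \<Sum>k\<in>?K. \<Sum>j\<in>?K. (c k * c j) * psi L (k + j) x) has_integral
      (\<Sum>k\<in>?K. \<Sum>j\<in>?K. (c k * c j) * (if k + j = 0 then of_real L else 0))) {0..L}"
    by (intro has_integral_sum has_integral_mult_right has_integral_psi assms(1)) auto
  moreover have "(\<Sum>k\<in>?K. \<Sum>j\<in>?K. (c k * c j) * (if k + j = 0 then of_real L else 0))
      = of_real L * (\<Sum>k\<in>?K. c k * c (- k))" (is "?l = _")
  proof -
    have "?l = (\<Sum>k\<in>?K. \<Sum>j\<in>?K. if j = - k then c k * c j * of_real L else 0)"
      by (intro sum.cong refl) auto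
    also have "\<dots> = (\<Sum>k\<in>?K. c k * c (- k) * of_real L)"
      by (intro sum.cong refl) (auto simp: sum.delta)
    finally show ?thesis by (simp add: sum_distrib_left mult_ac)
  qed
  moreover have "(\<Sum>k\<in>?K. \<Sum>j\<in>?K. (c k * c j) * psi L (k + j) x) = complex_of_real ((h x)\<^sup>2)" for x
    by (simp add: assms(2) power2_eq_square sum_product psi_mult[symmetric] mult_ac)
  ultimately have I: "((\<lambda>x. complex_of_real ((h x)\<^sup>2)) has_integral
      of_real L * (\<Sum>k\<in>?K. c k * c (- k))) {0..L}" by simp
  have h: "((\<lambda>x. (h x)\<^sup>2) has_integral Re (of_real L * (\<Sum>k\<in>?K. c k * c (- k)))) {0..L}"
    using has_integral_Re[OF I] by (simp only: Re_complex_of_real)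
  from has_integral_unique[OF has_integral_of_real[OF h] I] h
  show ?thesis
    by (simp add: integral_unique)
qed

lemma fourier_coeff_add:
  assumes "continuous_on {0..L} g" "continuous_on {0..L} h"
  shows "fourier_coeff L (\<lambda>x. g x + h x) j = fourier_coeff L g j + fourier_coeff L h j"
proof -
  have "(\<lambda>x. g x * psi L (- j) x) integrable_on {0..L}" "(\<lambda>x. h x * psi L (- j) x) integrable_on {0..L}"
    by (intro integrable_continuous_real continuous_on_mult assms continuous_on_psi)+
  then show ?thesis
    by (simp add: fourier_coeff_def distrib_right integral_add add_divide_distrib)
qed

lemma fourier_coeff_cmult:
  "fourier_coeff L (\<lambda>x. c * g x) j = c * fourier_coeff L g j"
  by (simp add: fourier_coeff_def mult.assoc)

lemma conv_add:
  assumes "continuous_on {0..L} g" "continuous_on {0..L} h"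
  shows "conv L NF e (\<lambda>x. g x + h x) k = conv L NF e g k + conv L NF e h k"
  by (simp add: conv_def fourier_coeff_add[OF assms] distrib_left sum.distrib)

lemma conv_cmult:
  "conv L NF e (\<lambda>x. c * g x) k = c * conv L NF e g k"
  by (simp add: conv_def fourier_coeff_cmult sum_distrib_left mult_ac)

lemma conv_diff_cmult:
  assumes "continuous_on {0..L} g" "continuous_on {0..L} h"
  shows "conv L NF e (\<lambda>x. of_real (g x - \<gamma> * h x)) k
    = conv L NF e (\<lambda>x. of_real (g x)) k - of_real \<gamma> * conv L NF e (\<lambda>x. of_real (h x)) k"
proof -
  have "conv L NF e (\<lambda>x. of_real (g x) + (- of_real \<gamma>) * of_real (h x)) k
    = conv L NF e (\<lambda>x. of_real (g x)) k + conv L NF e (\<lambda>x. (- of_real \<gamma>) * of_real (h x)) k"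
    by (intro conv_add continuous_intros assms)
  then show ?thesis
    unfolding conv_cmult by simp
qed

lemma conv_zero:
  assumes "\<And>x. x \<in> {0..L} \<Longrightarrow> h x = 0"
  shows "conv L NF e h k = 0"
proof -
  have "integral {0..L} (\<lambda>x. h x * psi L j x) = integral {0..L} (\<lambda>x. 0)" for j
    by (rule integral_cong) (simp add: assms)
  then show ?thesis by (simp add: conv_def fourier_coeff_def)
qed

lemma conv_0_trig_poly:
  assumes "L > 0" and "\<And>x. h x = (\<Sum>k\<in>{- int NF..int NF}. c k * psi L k x)"
  shows "conv L NF e h 0 = (\<Sum>k\<in>{- int NF..int NF}. e k * c (- k))"
  unfolding conv_def
  by (intro sum.cong refl arg_cong2[where f = "(*)"])
    (subst fourier_coeff_trig_poly[OF assms]; simp)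

lemma continuous_on_trig_poly:
  assumes "\<And>x. complex_of_real (h x) = (\<Sum>k\<in>K. c k * psi L k x)"
  shows "continuous_on S h"
proof -
  have "continuous_on S (\<lambda>x. Re (\<Sum>k\<in>K. c k * psi L k x))"
    by (intro continuous_intros continuous_on_psi)
  then show ?thesis
    by (simp add: assms[symmetric])
qed

lemma sum_reflect:
  "(\<Sum>k\<in>{- int NF..int NF}. g (- k)) = (\<Sum>k\<in>{- int NF..int NF}. g k)"
  by (rule sum.reindex_bij_witness[of _ uminus uminus]) auto


section \<open>Kinetic energy and boundary terms\<close>

lemma kinetic_moment:
  assumes "L > 0" "va < vb" "NL \<ge> 3"
    and C: "\<And>n x. n < NL \<Longrightarrow>
      complex_of_real (C n x) = (\<Sum>k\<in>{- int NF..int NF}. c n k * psi L k x)"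
  shows "complex_of_real (integral {0..L} (\<lambda>x. integral {va..vb}
      (\<lambda>v. v\<^sup>2 * (\<Sum>n<NL. C n x * phi va vb n v))))
    = of_real (L * (vb - va)) * (of_real (sigma va vb 1 * sigma va vb 2) * c 2 0
      + of_real (2 * sigma va vb 1 * sigma_bar va vb) * c 1 0
      + of_real ((sigma va vb 1)\<^sup>2 + (sigma va vb 0)\<^sup>2 + (sigma_bar va vb)\<^sup>2) * c 0 0)"
proof -
  \<comment> \<open>the second moment of \<open>\<phi>\<^sub>n\<close>, divided by \<open>v\<^sub>b - v\<^sub>a\<close>\<close>
  define a where "a = (\<lambda>n::nat. if n = 0 then (sigma va vb 1)\<^sup>2 + (sigma va vb 0)\<^sup>2 + (sigma_bar va vb)\<^sup>2
      else if n = 1 then 2 * sigma va vb 1 * sigma_bar va vb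
      else if n = 2 then sigma va vb 1 * sigma va vb 2 else 0)"
  have inner: "integral {va..vb} (\<lambda>v. v\<^sup>2 * (\<Sum>n<NL. C n x * phi va vb n v))
      = (\<Sum>n<NL. C n x * ((vb - va) * a n))" for x
  proof (rule integral_unique)
    have "((\<lambda>v. \<Sum>n<NL. C n x * (v\<^sup>2 * phi va vb n v)) has_integral
        (\<Sum>n<NL. C n x * ((vb - va) * a n))) {va..vb}"
      unfolding a_def
      by (intro has_integral_sum has_integral_mult_right has_integral_square_times_phi assms(2)) auto
    moreover have "(\<Sum>n<NL. C n x * (v\<^sup>2 * phi va vb n v)) = v\<^sup>2 * (\<Sum>n<NL. C n x * phi va vb n v)" for v
      by (simp add: sum_distrib_left mult_ac)
    ultimately show "((\<lambda>v. v\<^sup>2 * (\<Sum>n<NL. C n x * phi va vb n v)) has_integral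
        (\<Sum>n<NL. C n x * ((vb - va) * a n))) {va..vb}"
      by simp
  qed
  have "((\<lambda>x. \<Sum>n<NL. C n x * ((vb - va) * a n)) has_integral
      (\<Sum>n<NL. Re (of_real L * c n 0) * ((vb - va) * a n))) {0..L}"
    by (intro has_integral_sum has_integral_mult_left has_integral_trig_poly(1)[OF assms(1), where NF = NF] C) auto
  then have "complex_of_real (integral {0..L} (\<lambda>x. \<Sum>n<NL. C n x * ((vb - va) * a n)))
      = (\<Sum>n<NL. of_real (Re (of_real L * c n 0)) * of_real ((vb - va) * a n))"
    by (simp add: integral_unique)
  \<comment> \<open>the mean modes are real because the coefficient functions are\<close>
  also have "\<dots> = (\<Sum>n<NL. of_real L * c n 0 * of_real ((vb - va) * a n))"
  proof (intro sum.cong refl)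
    fix n assume "n \<in> {..<NL}"
    then have h: "\<And>x. complex_of_real (C n x) = (\<Sum>k\<in>{- int NF..int NF}. c n k * psi L k x)"
      by (simp add: C)
    have "complex_of_real (Re (of_real L * c n 0)) = of_real L * c n 0"
      using has_integral_trig_poly[OF assms(1) h] by (simp add: integral_unique)
    then show "of_real (Re (of_real L * c n 0)) * of_real ((vb - va) * a n)
        = of_real L * c n 0 * of_real ((vb - va) * a n)" by simp
  qed
  also have "\<dots> = (\<Sum>n\<in>{0,1,2}. of_real L * c n 0 * of_real ((vb - va) * a n))"
    using assms(3) by (intro sum.mono_neutral_right) (auto simp: a_def)
  finally show ?thesis
    unfolding inner by (simp add: a_def algebra_simps)
qed

lemma sigma_times_sigma_B:
  assumes "va < vb"
  shows "sigma va vb 1 * sigma_B va vb 1 0 = 1" "sigma va vb 2 * sigma_B va vb 2 1 = 2"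
proof -
  have "sqrt 3 * sqrt 3 = (3::real)" "sqrt 15 * sqrt 15 = (15::real)" by simp_all
  with assms show "sigma va vb 1 * sigma_B va vb 1 0 = 1" "sigma va vb 2 * sigma_B va vb 2 1 = 2"
    by (simp_all add: sigma_def sigma_B_def divide_simps)
qed

lemma op_B_low:
  "op_B va vb c 0 = 0"
  "op_B va vb c 1 = sigma_B va vb 1 0 * c 0"
  "op_B va vb c 2 = sigma_B va vb 2 1 * c 1"
  by (simp_all add: op_B_def numeral_2_eq_2 sigma_B_def)

lemma continuous_on_delta_v:
  assumes C: "\<And>n x. n < NL \<Longrightarrow>
      complex_of_real (C n x) = (\<Sum>k\<in>{- int NF..int NF}. c n k * psi L k x)"
    and f: "\<And>x v. f x v = (\<Sum>n<NL. C n x * phi va vb n v)"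
  shows "continuous_on S (\<lambda>x. delta_v va vb (\<lambda>v. f x v * phi va vb n v))"
proof -
  have cont: "continuous_on S (C j)" if "j < NL" for j
    using continuous_on_trig_poly[OF C[OF that]] .
  show ?thesis
    unfolding delta_v_def f divide_inverse
    by (intro continuous_intros cont) auto
qed

lemma B_kin_expand:
  assumes "\<And>n. continuous_on {0..L} (\<lambda>x. delta_v va vb (\<lambda>v. f x v * phi va vb n v))"
    and J_def: "\<And>n. J n = conv L NF e (\<lambda>x. of_real (delta_v va vb (\<lambda>v. f x v * phi va vb n v))) 0"
  shows "B_kin L va vb NF q \<gamma> e f = - of_real (\<gamma> * (q / 2) * (vb - va) * L) *
    (of_real (sigma va vb 1 * sigma va vb 2) * J 2
      + of_real (2 * sigma va vb 1 * sigma_bar va vb) * J 1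
      + of_real ((sigma va vb 1)\<^sup>2 + (sigma va vb 0)\<^sup>2 + (sigma_bar va vb)\<^sup>2) * J 0)"
proof -
  have c: "continuous_on {0..L} (\<lambda>x. complex_of_real a * of_real (delta_v va vb (\<lambda>v. f x v * phi va vb n v)))" for a n
    by (intro continuous_intros assms(1))
  have "of_real (sigma va vb 1 * sigma va vb 2) * J 2
      + of_real (2 * sigma va vb 1 * sigma_bar va vb) * J 1
      + of_real ((sigma va vb 1)\<^sup>2 + (sigma va vb 0)\<^sup>2 + (sigma_bar va vb)\<^sup>2) * J 0
    = conv L NF e (\<lambda>x. of_real
          (sigma va vb 1 * sigma va vb 2 * delta_v va vb (\<lambda>v. f x v * phi va vb 2 v)
           + 2 * sigma va vb 1 * sigma_bar va vb * delta_v va vb (\<lambda>v. f x v * phi va vb 1 v)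
           + ((sigma va vb 1)\<^sup>2 + (sigma va vb 0)\<^sup>2 + (sigma_bar va vb)\<^sup>2)
             * delta_v va vb (\<lambda>v. f x v * phi va vb 0 v))) 0"
    unfolding J_def conv_cmult[symmetric]
    by (subst conv_add[symmetric], (intro continuous_on_add c)+)+ (simp only: of_real_add of_real_mult)
  then show ?thesis
    unfolding B_kin_def by simp
qed

lemma boundary_terms_vanish:
  assumes "\<And>s x. x \<in> {0..L} \<Longrightarrow> f s x va = 0" "\<And>s x. x \<in> {0..L} \<Longrightarrow> f s x vb = 0"
  shows "B_kin L va vb NF q' \<gamma>' e (f s) = 0" "B_pot L va vb NF q m \<gamma> e f = 0"
proof -
  have 0: "conv L NF e (\<lambda>x. of_real (delta_v va vb (\<lambda>v. f s x v * phi va vb 0 v))) k = 0" for s k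
    by (rule conv_zero) (simp add: delta_v_def assms)
  show "B_pot L va vb NF q m \<gamma> e f = 0"
    unfolding B_pot_def Q_pot_def 0 by simp
  show "B_kin L va vb NF q' \<gamma>' e (f s) = 0"
    unfolding B_kin_def by (subst conv_zero) (simp_all add: delta_v_def assms)
qed

section \<open>Rates of change and conservation of energy\<close>

text \<open>
  The rate of the kinetic energy of one species, from the equations \<open>d0\<close>, \<open>d1\<close>, \<open>d2\<close> for its mean modes.
  Here \<open>J n\<close> is the boundary flux, and \<open>S n\<close> stands for \<open>\<Sum>\<^sub>k E\<^sub>k C\<^sub>n\<^sub>,\<^sub>-\<^sub>k\<close>, the mean mode of the product of
  field and coefficient.
\<close>

lemma kinetic_rate:
  fixes dC :: "nat \<Rightarrow> complex"
  assumes "va < vb" "m > 0"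
    and "\<And>n. continuous_on {0..L} (\<lambda>x. delta_v va vb (\<lambda>v. f x v * phi va vb n v))"
    and J_def: "\<And>n. J n = conv L NF e (\<lambda>x. of_real (delta_v va vb (\<lambda>v. f x v * phi va vb n v))) 0"
    and d0: "dC 0 = of_real (q / m) * (- of_real \<gamma> * J 0)"
    and d1: "dC 1 = of_real (q / m) * (of_real (sigma_B va vb 1 0) * S 0 - of_real \<gamma> * J 1)"
    and d2: "dC 2 = of_real (q / m) * (of_real (sigma_B va vb 2 1) * S 1 - of_real \<gamma> * J 2)"
  shows "of_real (m / 2) * (of_real (L * (vb - va)) * (of_real (sigma va vb 1 * sigma va vb 2) * dC 2
      + of_real (2 * sigma va vb 1 * sigma_bar va vb) * dC 1
      + of_real ((sigma va vb 1)\<^sup>2 + (sigma va vb 0)\<^sup>2 + (sigma_bar va vb)\<^sup>2) * dC 0))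
    = B_kin L va vb NF q \<gamma> e f
      + of_real (L * (vb - va)) * (of_real q * (of_real (sigma va vb 1) * S 1 + of_real (sigma_bar va vb) * S 0))"
proof -
  have s1: "complex_of_real (sigma va vb 1) * of_real (sigma_B va vb 1 0) = 1"
    and s2: "complex_of_real (sigma va vb 2) * of_real (sigma_B va vb 2 1) = 2"
    using sigma_times_sigma_B[OF assms(1)] by (simp_all flip: of_real_mult)
  define a b c where "a = complex_of_real (sigma va vb 1)" "b = complex_of_real (sigma va vb 2)"
    "c = complex_of_real (sigma_bar va vb)"
  define x y where "x = complex_of_real (sigma_B va vb 1 0)" "y = complex_of_real (sigma_B va vb 2 1)"
  have ax: "a * x = 1" and by2: "b * y = 2"
    using s1 s2 by (simp_all add: a_b_c_def x_y_def)
  define M where "M = complex_of_real ((sigma va vb 1)\<^sup>2 + (sigma va vb 0)\<^sup>2 + (sigma_bar va vb)\<^sup>2)"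
  define k where "k = complex_of_real (L * (vb - va))"
  have "a * b * (y * S 1 - of_real \<gamma> * J 2) + 2 * a * c * (x * S 0 - of_real \<gamma> * J 1) + M * (- of_real \<gamma> * J 0)
     = a * (b * y) * S 1 + 2 * c * (a * x) * S 0
       - of_real \<gamma> * (a * b * J 2 + 2 * a * c * J 1 + M * J 0)"
    by (simp add: algebra_simps)
  also have "\<dots> = 2 * (a * S 1 + c * S 0) - of_real \<gamma> * (a * b * J 2 + 2 * a * c * J 1 + M * J 0)"
    unfolding ax by2 by (simp add: algebra_simps)
  finally have e: "a * b * (y * S 1 - of_real \<gamma> * J 2) + 2 * a * c * (x * S 0 - of_real \<gamma> * J 1) + M * (- of_real \<gamma> * J 0)
    = 2 * (a * S 1 + c * S 0) - of_real \<gamma> * (a * b * J 2 + 2 * a * c * J 1 + M * J 0)" .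
  have "of_real (m / 2) * (k * (a * b * dC 2 + 2 * a * c * dC 1 + M * dC 0))
     = (of_real (m / 2) * of_real (q / m)) * k *
       (a * b * (y * S 1 - of_real \<gamma> * J 2) + 2 * a * c * (x * S 0 - of_real \<gamma> * J 1) + M * (- of_real \<gamma> * J 0))"
    unfolding d0 d1 d2 x_y_def by (simp only: algebra_simps)
  also have "complex_of_real (m / 2) * of_real (q / m) = of_real q / 2"
    using assms(2) by simp
  also have "of_real q / 2 * k * (a * b * (y * S 1 - of_real \<gamma> * J 2) + 2 * a * c * (x * S 0 - of_real \<gamma> * J 1) + M * (- of_real \<gamma> * J 0))
     = - of_real (\<gamma> * (q / 2) * (vb - va) * L) * (a * b * J 2 + 2 * a * c * J 1 + M * J 0)
       + k * (of_real q * (a * S 1 + c * S 0))"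
  proof -
    define R P z where "R = a * b * J 2 + 2 * a * c * J 1 + M * J 0" "P = a * S 1 + c * S 0" "z = vb - va"
    show ?thesis
      unfolding e k_def R_P_z_def[symmetric] by (simp add: field_simps)
  qed
  finally have "of_real (m / 2) * (k * (a * b * dC 2 + 2 * a * c * dC 1 + M * dC 0))
     = - of_real (\<gamma> * (q / 2) * (vb - va) * L) * (a * b * J 2 + 2 * a * c * J 1 + M * J 0)
       + k * (of_real q * (a * S 1 + c * S 0))" .
  then show ?thesis
    unfolding B_kin_expand[OF assms(3) J_def] M_def k_def a_b_c_def by simp
qed

text \<open>
  The rate of the field energy. Here \<open>de k\<close> is the time derivative of the field coefficient \<open>e k\<close>, tied to
  \<open>dC\<close> by the differentiated Poisson equation, and \<open>dC\<close> that of the densities \<open>C\<^sub>0\<^sub>,\<^sub>k\<close>, driven by a flux \<open>G\<close> and the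
  boundary penalty.
\<close>

lemma potential_rate:
  assumes "L > 0" "\<epsilon>0 > 0" "\<And>s. m s > 0"
    and E0: "e 0 = 0"
    and de: "\<And>k. k \<in> {- int NF..int NF} \<Longrightarrow> k \<noteq> 0 \<Longrightarrow>
      of_real \<epsilon>0 * wavenum L k * de k = of_real (vb - va) * (\<Sum>s\<in>{electron, ion}. of_real (q s) * dC s k)"
    and dC: "\<And>s k. k \<in> {- int NF..int NF} \<Longrightarrow> dC s k =
      - wavenum L k * G s k - of_real (q s / m s * \<gamma> s) *
          conv L NF e (\<lambda>x. of_real (delta_v va vb (\<lambda>v. f s x v * phi va vb 0 v))) k"
  shows "of_real (\<epsilon>0 * L) * (\<Sum>k\<in>{- int NF..int NF}. e k * de (- k))
    = B_pot L va vb NF q m \<gamma> e f - of_real (L * (vb - va)) *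
       (\<Sum>s\<in>{electron, ion}. of_real (q s) * (\<Sum>k\<in>{- int NF..int NF}. e k * G s (- k)))"
proof -
  let ?K = "{- int NF..int NF}"
  define Q where "Q = (\<lambda>s k. complex_of_real (\<gamma> s) * Q_pot L va vb NF (q s) (m s) e (f s) k)"
  have term_eq: "of_real (\<epsilon>0 * L) * de k =
      - of_real (L * (vb - va)) * (\<Sum>s\<in>{electron, ion}. of_real (q s) * G s k)
      - (\<Sum>s\<in>{electron, ion}. Q s k)" if k: "k \<in> ?K" "k \<noteq> 0" for k
  proof -
    define w where "w = wavenum L k"
    have w: "w \<noteq> 0" using k assms(1) by (simp add: w_def wavenum_eq_0_iff)
    have sp: "of_real (L * (vb - va)) * (inverse w * (of_real (q s) * dC s k))
       = - of_real (L * (vb - va)) * (of_real (q s) * G s k) - Q s k" for s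
    proof -
      define J where "J = conv L NF e (\<lambda>x. of_real (delta_v va vb (\<lambda>v. f s x v * phi va vb 0 v))) k"
      have "dC s k = - w * G s k - of_real (q s / m s * \<gamma> s) * J"
        unfolding dC[OF k(1)] w_def J_def ..
      moreover have "Q s k = of_real (L * (vb - va)) * (inverse w * (of_real (q s) * (of_real (q s / m s * \<gamma> s) * J)))"
        unfolding Q_def Q_pot_def J_def[symmetric] w_def[symmetric]
        by (simp add: power2_eq_square divide_inverse mult_ac)
      moreover have "inverse w * (of_real (q s) * (- w * G s k - of_real (q s / m s * \<gamma> s) * J))
         = - (of_real (q s) * G s k) - inverse w * (of_real (q s) * (of_real (q s / m s * \<gamma> s) * J))"
        using w by (simp add: field_simps)
      ultimately show ?thesis
        by (simp only: right_diff_distrib mult_minus_right mult_minus_left)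
    qed
    have "of_real \<epsilon>0 * de k = inverse w * (of_real \<epsilon>0 * w * de k)"
      using w by simp
    also have "\<dots> = inverse w * (of_real (vb - va) * (\<Sum>s\<in>{electron, ion}. of_real (q s) * dC s k))"
      unfolding w_def de[OF k] ..
    finally have "of_real L * (of_real \<epsilon>0 * de k)
       = of_real L * (inverse w * (of_real (vb - va) * (\<Sum>s\<in>{electron, ion}. of_real (q s) * dC s k)))"
      by (rule arg_cong)
    then have "of_real (\<epsilon>0 * L) * de k
       = (\<Sum>s\<in>{electron, ion}. of_real (L * (vb - va)) * (inverse w * (of_real (q s) * dC s k)))"
      by (simp only: of_real_mult sum_distrib_left mult_ac)
    then show ?thesis
      unfolding sp by (simp only: sum_subtractf sum_distrib_left)
  qed
  have "of_real (\<epsilon>0 * L) * (\<Sum>k\<in>?K. e k * de (- k)) = (\<Sum>k\<in>?K. e k * (of_real (\<epsilon>0 * L) * de (- k)))"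
    by (simp add: sum_distrib_left mult_ac)
  also have "\<dots> = (\<Sum>k\<in>?K. e k * (- of_real (L * (vb - va)) * (\<Sum>s\<in>{electron, ion}. of_real (q s) * G s (- k))
      - (\<Sum>s\<in>{electron, ion}. Q s (- k))))"
  proof (intro sum.cong refl)
    fix k assume "k \<in> ?K"
    then show "e k * (of_real (\<epsilon>0 * L) * de (- k)) = e k * (- of_real (L * (vb - va)) *
        (\<Sum>s\<in>{electron, ion}. of_real (q s) * G s (- k)) - (\<Sum>s\<in>{electron, ion}. Q s (- k)))"
      by (cases "k = 0") (simp add: E0, subst term_eq, simp_all)
  qed
  also have "\<dots> = - (\<Sum>k\<in>?K. e k * (\<Sum>s\<in>{electron, ion}. Q s (- k)))
      - of_real (L * (vb - va)) * (\<Sum>k\<in>?K. e k * (\<Sum>s\<in>{electron, ion}. of_real (q s) * G s (- k)))"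
  proof -
    have "(\<Sum>k\<in>?K. e k * (- c * A k - B k)) = - (\<Sum>k\<in>?K. e k * B k) - c * (\<Sum>k\<in>?K. e k * A k)"
      for c A B
      by (simp add: right_diff_distrib sum_subtractf sum_negf sum_distrib_left mult_ac)
    then show ?thesis .
  qed
  also have "(\<Sum>k\<in>?K. e k * (\<Sum>s\<in>{electron, ion}. Q s (- k)))
      = (\<Sum>k\<in>?K - {0}. e k * (\<Sum>s\<in>{electron, ion}. Q s (- k)))"
    by (rule sum.mono_neutral_right) (auto simp: E0)
  also have "(\<Sum>k\<in>?K. e k * (\<Sum>s\<in>{electron, ion}. of_real (q s) * G s (- k)))
      = (\<Sum>s\<in>{electron, ion}. of_real (q s) * (\<Sum>k\<in>?K. e k * G s (- k)))"
    unfolding sum_distrib_left by (subst sum.swap) (simp add: mult_ac)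
  finally show ?thesis
    unfolding B_pot_def Q_def .
qed

theorem mainTheorem6:
  fixes L va vb \<epsilon>0 :: real
    and NL NF :: nat
    and m q \<gamma> \<nu> :: "species \<Rightarrow> real"
    and T :: "real set"
    and Ck :: "species \<Rightarrow> real \<Rightarrow> nat \<Rightarrow> int \<Rightarrow> complex"
    and C :: "species \<Rightarrow> real \<Rightarrow> nat \<Rightarrow> real \<Rightarrow> real"
    and f :: "species \<Rightarrow> real \<Rightarrow> real \<Rightarrow> real \<Rightarrow> real"
    and Ek :: "real \<Rightarrow> int \<Rightarrow> complex"
    and E :: "real \<Rightarrow> real \<Rightarrow> real"
  assumes "L > 0" and "va < vb" and "NL \<ge> 4" and "\<epsilon>0 > 0"
    and "\<And>s. m s > 0" and "\<And>s. \<nu> s \<ge> 0"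
    and "is_interval T" and "interior T \<noteq> {}"
    and C_expansion: "\<And>s t n x. t \<in> T \<Longrightarrow> n < NL \<Longrightarrow>
      complex_of_real (C s t n x) = (\<Sum>k\<in>{- int NF..int NF}. Ck s t n k * psi L k x)"
    and f_expansion: "\<And>s t x v. t \<in> T \<Longrightarrow>
      f s t x v = (\<Sum>n<NL. C s t n x * phi va vb n v)"
    and E_expansion: "\<And>t x. t \<in> T \<Longrightarrow>
      complex_of_real (E t x) = (\<Sum>k\<in>{- int NF..int NF}. Ek t k * psi L k x)"
    and E_zero: "\<And>t. t \<in> T \<Longrightarrow> Ek t 0 = 0"
    and poisson: "\<And>t k. t \<in> T \<Longrightarrow> k \<in> {- int NF..int NF} \<Longrightarrow> k \<noteq> 0 \<Longrightarrow>
      of_real \<epsilon>0 * wavenum L k * Ek t k =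
        of_real (vb - va) * (\<Sum>s\<in>{electron, ion}. of_real (q s) * Ck s t 0 k)"
    and vlasov: "\<And>s t n k. t \<in> T \<Longrightarrow> n < NL \<Longrightarrow> k \<in> {- int NF..int NF} \<Longrightarrow>
      \<exists>dC. ((\<lambda>\<tau>. Ck s \<tau> n k) has_vector_derivative dC) (at t within T) \<and>
        dC + wavenum L k * op_A va vb NL (\<lambda>j. Ck s t j k) n
          - of_real (q s / m s) *
            conv L NF (Ek t)
              (\<lambda>x. of_real (op_B va vb (\<lambda>j. C s t j x) n
                     - \<gamma> s * delta_v va vb (\<lambda>v. f s t x v * phi va vb n v))) k
        = of_real (damping NL (\<nu> s) n) * Ck s t n k"
  shows "\<forall>t\<in>T.
    ((\<lambda>\<tau>. complex_of_real (total_energy L va vb \<epsilon>0 m (\<lambda>s. f s \<tau>) (E \<tau>)))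
       has_vector_derivative
       ((\<Sum>s\<in>{electron, ion}. B_kin L va vb NF (q s) (\<gamma> s) (Ek t) (f s t))
         + B_pot L va vb NF q m \<gamma> (Ek t) (\<lambda>s. f s t))) (at t within T)
    \<and> ((\<forall>s. \<forall>x\<in>{0..L}. f s t x va = 0 \<and> f s t x vb = 0) \<longrightarrow>
        (\<Sum>s\<in>{electron, ion}. B_kin L va vb NF (q s) (\<gamma> s) (Ek t) (f s t))
          + B_pot L va vb NF q m \<gamma> (Ek t) (\<lambda>s. f s t) = 0)"
proof (intro ballI conjI impI)
  let ?K = "{- int NF..int NF}"
  let ?S = "{electron, ion}"
  fix t assume t: "t \<in> T"
  define a where "a = complex_of_real (sigma va vb 1)"
  define b where "b = complex_of_real (sigma_bar va vb)"
  define J where "J = (\<lambda>s n k. conv L NF (Ek t)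
      (\<lambda>x. complex_of_real (delta_v va vb (\<lambda>v. f s t x v * phi va vb n v))) k)"
  define S where "S = (\<lambda>s n. \<Sum>k\<in>?K. Ek t k * Ck s t n (- k))"
  \<comment> \<open>the integral of \<open>v\<^sup>2 f\<close> over phase space for a distribution \<open>f\<close> whose mean modes are \<open>c\<close>\<close>
  define mom where "mom = (\<lambda>c :: nat \<Rightarrow> complex. of_real (L * (vb - va)) *
      (of_real (sigma va vb 1 * sigma va vb 2) * c 2
      + of_real (2 * sigma va vb 1 * sigma_bar va vb) * c 1
      + of_real ((sigma va vb 1)\<^sup>2 + (sigma va vb 0)\<^sup>2 + (sigma_bar va vb)\<^sup>2) * c 0))"
  have energy: "complex_of_real (total_energy L va vb \<epsilon>0 m (\<lambda>s. f s \<tau>) (E \<tau>))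
      = (\<Sum>s\<in>?S. of_real (m s / 2) * mom (\<lambda>n. Ck s \<tau> n 0))
        + of_real (\<epsilon>0 / 2) * (of_real L * (\<Sum>k\<in>?K. Ek \<tau> k * Ek \<tau> (- k)))" if "\<tau> \<in> T" for \<tau>
  proof -
    have "complex_of_real (integral {0..L} (\<lambda>x. integral {va..vb} (\<lambda>v. v\<^sup>2 * f s \<tau> x v)))
        = mom (\<lambda>n. Ck s \<tau> n 0)" for s
      unfolding f_expansion[OF that] mom_def
      using assms(1-3) C_expansion[OF that] by (intro kinetic_moment) auto
    moreover have "complex_of_real (integral {0..L} (\<lambda>x. (E \<tau> x)\<^sup>2))
        = of_real L * (\<Sum>k\<in>?K. Ek \<tau> k * Ek \<tau> (- k))"
      by (rule integral_trig_poly_square[OF assms(1) E_expansion[OF that]])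
    ultimately show ?thesis
      unfolding total_energy_def by (simp only: of_real_add of_real_mult of_real_sum)
  qed

  have contC: "continuous_on {0..L} (C s t n)" if "n < NL" for s n
    by (rule continuous_on_trig_poly[OF C_expansion[OF t that]])
  have contD: "continuous_on {0..L} (\<lambda>x. delta_v va vb (\<lambda>v. f s t x v * phi va vb n v))" for s n
    by (rule continuous_on_delta_v[OF C_expansion[OF t] f_expansion[OF t]])
  have contB: "continuous_on {0..L} (\<lambda>x. op_B va vb (\<lambda>j. C s t j x) n)" if "n < NL" for s n
    unfolding op_B_def using that by (intro continuous_intros contC) auto

  \<comment> \<open>\<open>rate s n k d\<close>: the coefficient has time derivative \<open>d\<close>, and \<open>d\<close> satisfies the evolution equation\<close>
  define rate where "rate = (\<lambda>s n k d. ((\<lambda>\<tau>. Ck s \<tau> n k) has_vector_derivative d) (at t within T) \<and>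
        d + wavenum L k * op_A va vb NL (\<lambda>j. Ck s t j k) n
          - of_real (q s / m s) *
            conv L NF (Ek t)
              (\<lambda>x. of_real (op_B va vb (\<lambda>j. C s t j x) n
                     - \<gamma> s * delta_v va vb (\<lambda>v. f s t x v * phi va vb n v))) k
        = of_real (damping NL (\<nu> s) n) * Ck s t n k)"
  define dC where "dC = (\<lambda>s n k. SOME d. rate s n k d)"
  have rate: "rate s n k (dC s n k)" if "n < NL" "k \<in> ?K" for s n k
    unfolding dC_def by (rule someI_ex) (use vlasov[OF t that] in \<open>simp only: rate_def\<close>)
  have dC: "((\<lambda>\<tau>. Ck s \<tau> n k) has_vector_derivative dC s n k) (at t within T)"
    and eq: "dC s n k + wavenum L k * op_A va vb NL (\<lambda>j. Ck s t j k) n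
          - of_real (q s / m s) *
            conv L NF (Ek t)
              (\<lambda>x. of_real (op_B va vb (\<lambda>j. C s t j x) n
                     - \<gamma> s * delta_v va vb (\<lambda>v. f s t x v * phi va vb n v))) k
        = of_real (damping NL (\<nu> s) n) * Ck s t n k" if "n < NL" "k \<in> ?K" for s n k
    using rate[OF that, of s] unfolding rate_def by (rule conjunct1, rule conjunct2)
  \<comment> \<open>collisions do not act on the first three Legendre modes\<close>
  have eq': "dC s n k = - wavenum L k * op_A va vb NL (\<lambda>j. Ck s t j k) n
      + of_real (q s / m s) * (conv L NF (Ek t) (\<lambda>x. of_real (op_B va vb (\<lambda>j. C s t j x) n)) k
          - of_real (\<gamma> s) * J s n k)" if "n < 3" "k \<in> ?K" for s n k
  proof -
    have n: "n < NL" using that assms(3) by simp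
    have "damping NL (\<nu> s) n = 0"
      using that(1) by (auto simp: damping_def less_Suc_eq numeral_3_eq_3)
    then show ?thesis
      using eq[OF n that(2), of s] unfolding conv_diff_cmult[OF contB[OF n] contD] J_def
      by (simp add: algebra_simps)
  qed
  have d0: "dC s 0 k = - wavenum L k * (a * Ck s t 1 k + b * Ck s t 0 k)
      - of_real (q s / m s * \<gamma> s) * J s 0 k" if "k \<in> ?K" for s k
  proof -
    have "op_A va vb NL (\<lambda>j. Ck s t j k) 0 = a * Ck s t 1 k + b * Ck s t 0 k"
      using assms(3) by (simp add: op_A_def a_def b_def sigma_def)
    then show ?thesis
      using eq'[of 0 k s] that by (simp add: op_B_low conv_zero)
  qed
  have w0: "wavenum L 0 = 0" by (simp add: wavenum_def)
  have conv_C: "conv L NF (Ek t) (\<lambda>x. complex_of_real (c * C s t n x)) 0 = of_real c * S s n"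
    if "n < NL" for s n c
    unfolding of_real_mult conv_cmult S_def conv_0_trig_poly[OF assms(1) C_expansion[OF t that]] ..
  have kin: "of_real (m s / 2) * mom (\<lambda>n. dC s n 0) = B_kin L va vb NF (q s) (\<gamma> s) (Ek t) (f s t)
      + of_real (L * (vb - va)) * (of_real (q s) * (a * S s 1 + b * S s 0))" for s
    unfolding mom_def a_def b_def
  proof (rule kinetic_rate[OF assms(2) assms(5) contD])
    show "J s n 0 = conv L NF (Ek t)
      (\<lambda>x. complex_of_real (delta_v va vb (\<lambda>v. f s t x v * phi va vb n v))) 0" for n
      by (simp add: J_def)
    show "dC s 0 0 = of_real (q s / m s) * (- of_real (\<gamma> s) * J s 0 0)"
      using d0[of 0 s] by (simp add: w0)
    show "dC s 1 0 = of_real (q s / m s) * (of_real (sigma_B va vb 1 0) * S s 0 - of_real (\<gamma> s) * J s 1 0)"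
      using eq'[of 1 0 s] assms(3) unfolding op_B_low(2) by (simp add: conv_C w0 del: of_real_mult)
    show "dC s 2 0 = of_real (q s / m s) * (of_real (sigma_B va vb 2 1) * S s 1 - of_real (\<gamma> s) * J s 2 0)"
      using eq'[of 2 0 s] assms(3) unfolding op_B_low(3) by (simp add: conv_C w0 del: of_real_mult)
  qed

  \<comment> \<open>no evolution equation is given for the field: its derivative comes from the Poisson equation\<close>
  define dE where "dE = (\<lambda>k. if k = 0 then 0 else
      of_real (vb - va) / (of_real \<epsilon>0 * wavenum L k) * (\<Sum>s\<in>?S. of_real (q s) * dC s 0 k))"
  have wk: "of_real \<epsilon>0 * wavenum L k \<noteq> 0" if "k \<noteq> 0" for k
    using that assms(1,4) by (simp add: wavenum_eq_0_iff)
  have dE: "((\<lambda>\<tau>. Ek \<tau> k) has_vector_derivative dE k) (at t within T)" if k: "k \<in> ?K" for k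
  proof (cases "k = 0")
    case True
    have "((\<lambda>\<tau>. 0 :: complex) has_vector_derivative 0) (at t within T)" by simp
    then show ?thesis
      unfolding True dE_def using E_zero t
      by (auto intro: has_vector_derivative_transform[of t T _ "\<lambda>\<tau>. 0"])
  next
    case False
    have D: "((\<lambda>\<tau>. of_real (vb - va) / (of_real \<epsilon>0 * wavenum L k) * (\<Sum>s\<in>?S. of_real (q s) * Ck s \<tau> 0 k))
        has_vector_derivative dE k) (at t within T)"
      unfolding dE_def if_not_P[OF False] using assms(3) k
      by (intro has_vector_derivative_mult_right has_vector_derivative_sum dC) auto
    have "Ek \<tau> k = of_real (vb - va) / (of_real \<epsilon>0 * wavenum L k) * (\<Sum>s\<in>?S. of_real (q s) * Ck s \<tau> 0 k)"
      if "\<tau> \<in> T" for \<tau>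
    proof -
      have "(of_real \<epsilon>0 * wavenum L k) * Ek \<tau> k = of_real (vb - va) * (\<Sum>s\<in>?S. of_real (q s) * Ck s \<tau> 0 k)"
        using poisson[OF that k False] .
      then show ?thesis
        using wk[OF False] by (simp add: nonzero_eq_divide_eq mult.commute)
    qed
    then show ?thesis
      by (rule has_vector_derivative_transform[OF t _ D])
  qed

  have pot: "of_real (\<epsilon>0 * L) * (\<Sum>k\<in>?K. Ek t k * dE (- k))
      = B_pot L va vb NF q m \<gamma> (Ek t) (\<lambda>s. f s t)
        - of_real (L * (vb - va)) * (\<Sum>s\<in>?S. of_real (q s) *
            (\<Sum>k\<in>?K. Ek t k * (a * Ck s t 1 (- k) + b * Ck s t 0 (- k))))"
  proof (rule potential_rate[where e = "Ek t", OF assms(1,4,5) E_zero[OF t]])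
    show "of_real \<epsilon>0 * wavenum L k * dE k = of_real (vb - va) * (\<Sum>s\<in>?S. of_real (q s) * dC s 0 k)"
      if "k \<noteq> 0" for k
      unfolding dE_def if_not_P[OF that] using wk[OF that] by simp
    show "dC s 0 k = - wavenum L k * (a * Ck s t 1 k + b * Ck s t 0 k)
       - of_real (q s / m s * \<gamma> s) * conv L NF (Ek t)
        (\<lambda>x. of_real (delta_v va vb (\<lambda>v. f s t x v * phi va vb 0 v))) k" if "k \<in> ?K" for s k
      using d0[OF that, of s] unfolding J_def .
  qed
  have SS: "(\<Sum>k\<in>?K. Ek t k * (a * Ck s t 1 (- k) + b * Ck s t 0 (- k))) = a * S s 1 + b * S s 0" for s
    unfolding S_def sum_distrib_left sum.distrib[symmetric]
    by (intro sum.cong refl) (simp add: algebra_simps)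

  have D: "((\<lambda>\<tau>. (\<Sum>s\<in>?S. of_real (m s / 2) * mom (\<lambda>n. Ck s \<tau> n 0))
        + of_real (\<epsilon>0 / 2) * (of_real L * (\<Sum>k\<in>?K. Ek \<tau> k * Ek \<tau> (- k))))
     has_vector_derivative
       (\<Sum>s\<in>?S. of_real (m s / 2) * mom (\<lambda>n. dC s n 0))
        + of_real (\<epsilon>0 / 2) * (of_real L * (\<Sum>k\<in>?K. Ek t k * dE (- k) + dE k * Ek t (- k)))) (at t within T)"
    unfolding mom_def using assms(3)
    by (intro has_vector_derivative_add has_vector_derivative_mult_right has_vector_derivative_sum
        has_vector_derivative_mult dC dE) auto
  have "(\<Sum>s\<in>?S. of_real (m s / 2) * mom (\<lambda>n. dC s n 0))
        + of_real (\<epsilon>0 / 2) * (of_real L * (\<Sum>k\<in>?K. Ek t k * dE (- k) + dE k * Ek t (- k)))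
     = (\<Sum>s\<in>?S. B_kin L va vb NF (q s) (\<gamma> s) (Ek t) (f s t)) + B_pot L va vb NF q m \<gamma> (Ek t) (\<lambda>s. f s t)"
  proof -
    have "(\<Sum>k\<in>?K. dE k * Ek t (- k)) = (\<Sum>k\<in>?K. Ek t k * dE (- k))"
      using sum_reflect[of "\<lambda>k. Ek t k * dE (- k)" NF] by (simp add: mult.commute)
    then have "of_real (\<epsilon>0 / 2) * (of_real L * (\<Sum>k\<in>?K. Ek t k * dE (- k) + dE k * Ek t (- k)))
        = of_real (\<epsilon>0 * L) * (\<Sum>k\<in>?K. Ek t k * dE (- k))"
      by (simp add: sum.distrib)
    then show ?thesis
      unfolding pot SS kin by (simp add: algebra_simps)
  qed
  then show "((\<lambda>\<tau>. complex_of_real (total_energy L va vb \<epsilon>0 m (\<lambda>s. f s \<tau>) (E \<tau>)))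
       has_vector_derivative
       ((\<Sum>s\<in>{electron, ion}. B_kin L va vb NF (q s) (\<gamma> s) (Ek t) (f s t))
         + B_pot L va vb NF q m \<gamma> (Ek t) (\<lambda>s. f s t))) (at t within T)"
    using has_vector_derivative_transform[OF t energy D] by (simp only:)
next
  fix t assume "\<forall>s. \<forall>x\<in>{0..L}. f s t x va = 0 \<and> f s t x vb = 0"
  then show "(\<Sum>s\<in>{electron, ion}. B_kin L va vb NF (q s) (\<gamma> s) (Ek t) (f s t))
          + B_pot L va vb NF q m \<gamma> (Ek t) (\<lambda>s. f s t) = 0"
    using boundary_terms_vanish[of L "\<lambda>s. f s t" va vb] by simp
qed

end
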